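(* Let $r\ge 2$ and let $h:\mathbb{N}^r\to \mathbb{C}$, $g:\mathbb{N}^r\to \mathbb{C}$, $f_j:\mathbb{N}\to \mathbb{C}$ ($1\le j\le r$) be arithmetic functions such that \[ h(n_1,\ldots,n_r) = \sum_{d_1m_1=n_1,\ldots, d_rm_r=n_r} g(d_1,\ldots, d_r) f_1(m_1)\cdots f_r(m_r) \] for every $n_1,\ldots,n_r\in \mathbb{N}$. Assume that (i) there exist constants $0<b_j<a_j$ ($1\le j\le r$) such that \[ F_j(x):= \sum_{n\le x} f_j(n)= x^{a_j}P_j(\log x)+ O(x^{b_j}) \quad (1\le j\le r), \] where $P_j(u)$ is a polynomial in $u$ of degree $\delta_j$ with leading coefficient $K_j$ ($1\le j\le r$); (ii) the Dirichlet series \[ G(s_1,\ldots,s_r):= \sum_{n_1,\ldots, n_r=1}^{\infty} \frac{g(n_1,\ldots,n_r)}{n_1^{s_1}\cdots n_r^{s_r}} \] is absolutely convergent at $(s_1,\ldots, s_r)=(a_1-\varepsilon,\ldots,a_{j-1}-\varepsilon, b_j-\varepsilon, a_{j+1}-\varepsilon, \ldots, a_r-\varepsilon)$ for all sufficiently small $\varepsilon>0$ and every $1\le j\le r$. Then \[ \sum_{n_1,\ldots, n_r\le x} h(n_1,\ldots,n_r) = x^{a_1+\cdots+a_r} Q(\log x) + O\big(x^{a_1+\cdots+a_r -\Delta}(\log x)^{\delta_1+\cdots +\delta_r}\big), \] where $Q(u)$ is a polynomial in $u$ of degree $\delta_1+\cdots +\delta_r$ with leading coefficient $K_1\cdots K_r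 G(a_1,\ldots,a_r)$, and $\Delta =\min_{1\le j\le r} (a_j-b_j)$.
   Context: $\mathbb{N}=\{1,2,\ldots\}$.
   Formalization: If G(a_1,…,a_r)=0 then Q cannot have degree δ_1+…+δ_r with leading coefficient 0; what is proved is that Q has degree at most δ_1+…+δ_r and its coefficient there is K_1⋯K_r G(a_1,…,a_r), with degree exactly δ_1+…+δ_r when this is nonzero. *)

theory Defs
  imports "HOL-Analysis.Analysis" "HOL-Library.Landau_Symbols"
    "HOL-Computational_Algebra.Polynomial"
begin

text \<open>
  An \<open>r\<close>-tuple is a function on a finite index type \<open>'r\<close> with \<open>CARD('r) = r\<close>.
  The natural numbers of the source start at 1, so arithmetic functions are only ever
  evaluated and summed over positive arguments; their values elsewhere are irrelevant.
\<close>

definition pos_tuples :: "('r::finite \<Rightarrow> nat) set" where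
  "pos_tuples = {n. \<forall>j. 1 \<le> n j}"

definition summatory :: "(nat \<Rightarrow> complex) \<Rightarrow> real \<Rightarrow> complex" where
  "summatory f x = (\<Sum>n | 1 \<le> n \<and> real n \<le> x. f n)"

definition msummatory :: "(('r::finite \<Rightarrow> nat) \<Rightarrow> complex) \<Rightarrow> real \<Rightarrow> complex" where
  "msummatory h x = (\<Sum>n | n \<in> pos_tuples \<and> (\<forall>j. real (n j) \<le> x). h n)"

text \<open>For \<open>n \<in> pos_tuples\<close> the index set is finite and all \<open>d j\<close>, \<open>m j\<close> are positive.\<close>

definition mconvolution ::
    "(('r::finite \<Rightarrow> nat) \<Rightarrow> complex) \<Rightarrow> ('r \<Rightarrow> nat \<Rightarrow> complex) \<Rightarrow> ('r \<Rightarrow> nat) \<Rightarrow> complex" where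
  "mconvolution g f n =
     (\<Sum>(d, m) | \<forall>j. d j * m j = n j. g d * (\<Prod>j\<in>UNIV. f j (m j)))"

definition mdirichlet_term ::
    "(('r::finite \<Rightarrow> nat) \<Rightarrow> complex) \<Rightarrow> ('r \<Rightarrow> complex) \<Rightarrow> ('r \<Rightarrow> nat) \<Rightarrow> complex" where
  "mdirichlet_term g s n = g n / (\<Prod>j\<in>UNIV. of_nat (n j) powr s j)"

definition mdirichlet_abs_conv ::
    "(('r::finite \<Rightarrow> nat) \<Rightarrow> complex) \<Rightarrow> ('r \<Rightarrow> complex) \<Rightarrow> bool" where
  "mdirichlet_abs_conv g s \<longleftrightarrow> (\<lambda>n. norm (mdirichlet_term g s n)) summable_on pos_tuples"

definition mdirichlet ::
    "(('r::finite \<Rightarrow> nat) \<Rightarrow> complex) \<Rightarrow> ('r \<Rightarrow> complex) \<Rightarrow> complex" where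
  "mdirichlet g s = (\<Sum>\<^sub>\<infinity>n\<in>pos_tuples. mdirichlet_term g s n)"

end

theory Submission
  imports Defs
begin

text \<open>
  Since the summatory functions vanish on \<open>(0,1)\<close>, the sum of \<open>h\<close> over the box is the sum of
  \<open>g d * (\<Prod>j. F j (x / d j))\<close> over all tuples \<open>d\<close>. Replacing every \<open>F j y\<close> by its main term
  \<open>y powr a j * P j (ln y)\<close> costs \<open>O(y powr b j)\<close> uniformly in \<open>y > 0\<close>, and telescoping the
  difference of products leaves one factor of size \<open>(x / d j) powr b j\<close> while the others have
  size \<open>(x / d i) powr a i\<close> up to logarithms. The powers of \<open>ln (d i)\<close> are absorbed by
  \<open>d i powr \<epsilon>\<close>, so absolute convergence of \<open>G\<close> at the shifted points bounds the error.
  Expanding the main terms in powers of \<open>ln x\<close> gives the coefficients of \<open>Q\<close> as absolutely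
  convergent series over all \<open>d\<close>, so no separate tail estimate is needed.
\<close>

section \<open>Growth of polynomials: powers and exponentials as majorants\<close>

text \<open>The base \<open>1 + norm u\<close> is at least 1, so the top power dominates all lower
  ones. The exponent is kept equal to the degree because it becomes the power of the logarithm in
  the error term.\<close>

lemma norm_poly_le_power_degree:
  fixes p :: "complex poly"
  shows "\<exists>c\<ge>0. \<forall>u. norm (poly p u) \<le> c * (1 + norm u) ^ degree p"
proof (intro exI conjI allI)
  show "0 \<le> (\<Sum>i\<le>degree p. norm (coeff p i))" by (simp add: sum_nonneg)
  fix u
  have "norm (poly p u) \<le> (\<Sum>i\<le>degree p. norm (coeff p i * u ^ i))"
    unfolding poly_altdef by (rule norm_sum)
  also have "\<dots> \<le> (\<Sum>i\<le>degree p. norm (coeff p i) * (1 + norm u) ^ degree p)"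
  proof (rule sum_mono)
    fix i assume "i \<in> {..degree p}"
    have "norm u ^ i \<le> (1 + norm u) ^ i" by (intro power_mono) auto
    also have "\<dots> \<le> (1 + norm u) ^ degree p"
      using \<open>i \<in> _\<close> by (intro power_increasing) auto
    finally show "norm (coeff p i * u ^ i) \<le> norm (coeff p i) * (1 + norm u) ^ degree p"
      by (simp add: norm_mult norm_power mult_left_mono)
  qed
  finally show "norm (poly p u) \<le> (\<Sum>i\<le>degree p. norm (coeff p i)) * (1 + norm u) ^ degree p"
    by (simp add: sum_distrib_right)
qed

text \<open>With \<open>w = n / \<epsilon>\<close> and \<open>v = u / w\<close>, we have
  \<open>1 + u \<le> (1 + w) * (1 + v) \<le> (1 + w) * exp v\<close>; the \<open>n\<close>-th power
  of \<open>exp v\<close> is \<open>exp (\<epsilon> * u)\<close>. At \<open>u = ln k\<close> this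
  absorbs powers of logarithms into \<open>k powr \<epsilon>\<close>.\<close>

lemma power_le_exp:
  fixes \<epsilon> :: real
  assumes "\<epsilon> > 0"
  shows "\<exists>c\<ge>0. \<forall>u\<ge>0. (1 + u) ^ n \<le> c * exp (\<epsilon> * u)"
proof (intro exI conjI allI impI)
  define w where "w = real n / \<epsilon>"
  have w: "w \<ge> 0" using assms by (simp add: w_def)
  define c where "c = 1 + w"
  have c: "c \<ge> 1" using w by (simp add: c_def)
  show "0 \<le> c ^ n" using c by simp
  fix u :: real assume u: "u \<ge> 0"
  show "(1 + u) ^ n \<le> c ^ n * exp (\<epsilon> * u)"
  proof (cases "n = 0")
    case True then show ?thesis using assms u by simp
  next
    case False
    define v where "v = \<epsilon> * u / n"
    have v: "v \<ge> 0" using assms u by (simp add: v_def)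
    have u_eq: "u = w * v" using assms False by (simp add: v_def w_def)
    have "1 + u \<le> c * (1 + v)"
      unfolding c_def u_eq using v w by (simp add: algebra_simps)
    also have "\<dots> \<le> c * exp v" using c by (intro mult_left_mono exp_ge_add_one_self) auto
    finally have "(1 + u) ^ n \<le> (c * exp v) ^ n" using u by (intro power_mono) auto
    also have "\<dots> = c ^ n * exp (\<epsilon> * u)"
      using False by (simp add: power_mult_distrib exp_of_nat_mult [symmetric] v_def)
    finally show ?thesis .
  qed
qed

lemma norm_poly_le_exp:
  fixes p :: "complex poly" and \<epsilon> :: real
  assumes "\<epsilon> > 0"
  shows "\<exists>c\<ge>0. \<forall>u. norm (poly p u) \<le> c * exp (\<epsilon> * norm u)"
proof -
  obtain c where c: "c \<ge> 0" "\<And>u. norm (poly p u) \<le> c * (1 + norm u) ^ degree p"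
    using norm_poly_le_power_degree by blast
  obtain c' where c': "c' \<ge> 0" "\<And>u. u \<ge> 0 \<Longrightarrow> (1 + u) ^ degree p \<le> c' * exp (\<epsilon> * u)"
    using power_le_exp [OF assms] by blast
  have "norm (poly p u) \<le> (c * c') * exp (\<epsilon> * norm u)" for u
  proof -
    have "norm (poly p u) \<le> c * (1 + norm u) ^ degree p" by (rule c)
    also have "\<dots> \<le> c * (c' * exp (\<epsilon> * norm u))" using c c' by (intro mult_left_mono) auto
    finally show ?thesis by (simp add: mult_ac)
  qed
  then show ?thesis using c c' by (intro exI [of _ "c * c'"]) auto
qed

section \<open>One variable: summatory functions and their main terms\<close>

definition asymp_main :: "real \<Rightarrow> complex poly \<Rightarrow> real \<Rightarrow> complex" where
  "asymp_main a p y = complex_of_real (y powr a) * poly p (complex_of_real (ln y))"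

lemma finite_pos_nat_le_real: "finite {n. 1 \<le> n \<and> real n \<le> x}"
  by (rule finite_subset [of _ "{..nat \<lfloor>x\<rfloor>}"]) (auto simp: le_nat_floor)

lemma summatory_eq_0: "x < 1 \<Longrightarrow> summatory f x = 0"
  unfolding summatory_def by (rule sum.neutral) auto

text \<open>Write \<open>y powr a\<close> as \<open>y powr b * y powr (a - b)\<close>. For
  \<open>y \<le> 1\<close> the second factor exactly cancels the bound
  \<open>exp ((a - b) * \<bar>ln y\<bar>)\<close> for the polynomial; for
  \<open>1 < y \<le> Y\<close> the product is at most a constant.\<close>

lemma norm_asymp_main_le:
  fixes a b :: real
  assumes "b < a"
  shows "\<exists>c\<ge>0. \<forall>y. 0 < y \<longrightarrow> y \<le> Y \<longrightarrow> norm (asymp_main a p y) \<le> c * y powr b"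
proof -
  obtain c where c: "c \<ge> 0" "\<And>u. norm (poly p u) \<le> c * exp ((a - b) * norm u)"
    using norm_poly_le_exp [of "a - b" p] assms by auto
  define Z where "Z = max 1 Y"
  have "norm (asymp_main a p y) \<le> (c * Z powr (2 * (a - b))) * y powr b"
    if y: "0 < y" "y \<le> Y" for y
  proof -
    have "y powr (a - b) * exp ((a - b) * \<bar>ln y\<bar>) \<le> Z powr (2 * (a - b))"
    proof (cases "y \<le> 1")
      case True
      then have "y powr (a - b) * exp ((a - b) * \<bar>ln y\<bar>) = 1"
        using y by (simp add: powr_def exp_add [symmetric])
      also have "\<dots> \<le> Z powr (2 * (a - b))"
        using assms by (intro ge_one_powr_ge_zero) (auto simp: Z_def)
      finally show ?thesis .
    next
      case False
      then have "y powr (a - b) * exp ((a - b) * \<bar>ln y\<bar>) = y powr (2 * (a - b))"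
        using y by (simp add: powr_def exp_add [symmetric] algebra_simps)
      also have "\<dots> \<le> Z powr (2 * (a - b))"
        using assms y by (intro powr_mono2) (auto simp: Z_def)
      finally show ?thesis .
    qed
    then have *: "c * y powr b * (y powr (a - b) * exp ((a - b) * \<bar>ln y\<bar>)) \<le> c * y powr b * Z powr (2 * (a - b))"
      using c by (intro mult_left_mono) auto
    have "norm (asymp_main a p y) \<le> y powr a * (c * exp ((a - b) * \<bar>ln y\<bar>))"
      unfolding asymp_main_def norm_mult using c(2) [of "complex_of_real (ln y)"]
      by (intro mult_mono) auto
    also have "y powr a = y powr b * y powr (a - b)" by (simp add: powr_add [symmetric])
    finally show ?thesis using * by (simp add: mult_ac)
  qed
  then show ?thesis using c by (intro exI [of _ "c * Z powr (2 * (a - b))"]) auto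
qed

text \<open>The summatory function vanishes on \<open>(0,1)\<close>, where the main term is already
  dominated by \<open>y powr b\<close>, so the asymptotic estimate at infinity is uniform.\<close>

lemma summatory_error_bound:
  fixes a b :: real
  assumes "0 < b" "b < a"
    and "(\<lambda>x. summatory f x - asymp_main a p x) \<in> O[at_top](\<lambda>x. complex_of_real (x powr b))"
  shows "\<exists>c\<ge>0. \<forall>y>0. norm (summatory f y - asymp_main a p y) \<le> c * y powr b"
proof -
  obtain c1 where c1: "c1 > 0"
    and ev: "\<forall>\<^sub>F x in at_top. norm (summatory f x - asymp_main a p x) \<le> c1 * norm (complex_of_real (x powr b))"
    using assms(3) by (elim landau_o.bigE)
  then obtain Y where Y: "\<And>x. x \<ge> Y \<Longrightarrow> norm (summatory f x - asymp_main a p x) \<le> c1 * x powr b"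
    unfolding eventually_at_top_linorder by auto
  obtain c2 where c2: "c2 \<ge> 0" "\<And>y. 0 < y \<Longrightarrow> y \<le> Y \<Longrightarrow> norm (asymp_main a p y) \<le> c2 * y powr b"
    using norm_asymp_main_le [OF assms(2)] by blast
  \<comment> \<open>All partial sums of \<open>f\<close> up to \<open>Y\<close> are bounded by this
    one finite sum of norms. The factor \<open>y powr b\<close> may be inserted because it is at
    least 1 for \<open>y \<ge> 1\<close>, as \<open>b > 0\<close>.\<close>
  define c3 where "c3 = (\<Sum>n | 1 \<le> n \<and> real n \<le> Y. norm (f n))"
  have c3: "c3 \<ge> 0" unfolding c3_def by (simp add: sum_nonneg)
  have c3': "norm (summatory f y) \<le> c3 * y powr b" if "0 < y" "y \<le> Y" for y
  proof (cases "y < 1")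
    case True then show ?thesis using c3 by (simp add: summatory_eq_0)
  next
    case False
    have "norm (summatory f y) \<le> (\<Sum>n | 1 \<le> n \<and> real n \<le> y. norm (f n))"
      unfolding summatory_def by (rule norm_sum)
    also have "\<dots> \<le> c3" unfolding c3_def
      using that finite_pos_nat_le_real by (intro sum_mono2) auto
    also have "\<dots> \<le> c3 * y powr b"
      using mult_left_mono [OF ge_one_powr_ge_zero [of y b] c3] False assms by simp
    finally show ?thesis .
  qed
  have "norm (summatory f y - asymp_main a p y) \<le> (c1 + c2 + c3) * y powr b" if y: "y > 0" for y
  proof (cases "y \<ge> Y")
    case True
    have "c1 * y powr b \<le> (c1 + c2 + c3) * y powr b" using c2 c3 by (intro mult_right_mono) auto
    with Y [OF True] show ?thesis by linarith
  next
    case False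
    have "norm (summatory f y - asymp_main a p y) \<le> c3 * y powr b + c2 * y powr b"
      using False y c2 c3' by (intro norm_triangle_le_diff add_mono) auto
    also have "\<dots> \<le> (c1 + c2 + c3) * y powr b" using c1 by (simp add: algebra_simps)
    finally show ?thesis .
  qed
  then show ?thesis using c1 c2 c3 by (intro exI [of _ "c1 + c2 + c3"]) auto
qed

text \<open>Separates \<open>x\<close> from the divisor \<open>n\<close>: the logarithm of
  \<open>x\<close> keeps its power, while that of \<open>n\<close> is absorbed by
  \<open>n powr \<epsilon>\<close>. Nothing restricts \<open>n\<close> by \<open>x\<close>, so the
  bounds can be summed over all tuples, and the three share one shape and one constant.\<close>

lemma summatory_divisor_bounds:
  fixes a b \<epsilon> :: real
  assumes "0 < b" "b < a" "\<epsilon> > 0"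
    and "(\<lambda>x. summatory f x - asymp_main a p x) \<in> O[at_top](\<lambda>x. complex_of_real (x powr b))"
  shows "\<exists>c\<ge>0. \<forall>x\<ge>1. \<forall>n\<ge>1::nat.
    norm (summatory f (x / n) - asymp_main a p (x / n))
      \<le> c * x powr b * (1 + ln x) ^ degree p * n powr -(b - \<epsilon>) \<and>
    norm (asymp_main a p (x / n)) \<le> c * x powr a * (1 + ln x) ^ degree p * n powr -(a - \<epsilon>) \<and>
    norm (summatory f (x / n)) \<le> c * x powr a * (1 + ln x) ^ degree p * n powr -(a - \<epsilon>)"
proof -
  define \<delta> where "\<delta> = degree p"
  obtain c1 where c1: "c1 \<ge> 0" "\<And>y. y > 0 \<Longrightarrow> norm (summatory f y - asymp_main a p y) \<le> c1 * y powr b"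
    using summatory_error_bound [OF assms(1,2,4)] by blast
  obtain c2 where c2: "c2 \<ge> 0" "\<And>u. norm (poly p u) \<le> c2 * (1 + norm u) ^ \<delta>"
    using norm_poly_le_power_degree unfolding \<delta>_def by blast
  obtain c3 where c3: "c3 \<ge> 0" "\<And>u. u \<ge> 0 \<Longrightarrow> (1 + u) ^ \<delta> \<le> c3 * exp (\<epsilon> * u)"
    using power_le_exp [OF assms(3)] by blast
  \<comment> \<open>\<open>c1\<close> serves the error, \<open>c2 * c3\<close> the main term, and
    their sum the summatory function.\<close>
  define c where "c = c1 + c2 * c3"
  have c: "c \<ge> 0" using c1 c2 c3 by (simp add: c_def)
  show ?thesis unfolding \<delta>_def [symmetric]
  proof (intro exI [of _ c] conjI allI impI)
    show "c \<ge> 0" by (fact c)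
    fix x :: real and n :: nat
    assume x: "x \<ge> 1" and n: "n \<ge> 1"
    have L: "(1 + ln x) ^ \<delta> \<ge> 1" using x by (intro one_le_power) auto
    have n\<epsilon>: "real n powr \<epsilon> \<ge> 1" using n assms by (intro ge_one_powr_ge_zero) auto
    have split: "(x / n) powr t * n powr \<epsilon> = x powr t * n powr -(t - \<epsilon>)" for t
      using x n by (simp add: powr_divide powr_minus powr_diff field_simps)
    \<comment> \<open>Two factors that are at least 1 are inserted, to give this estimate the same
      shape as the one for the main term.\<close>
    have weaken: "c1 * (x / n) powr t \<le> c1 * x powr t * (1 + ln x) ^ \<delta> * n powr -(t - \<epsilon>)" for t
    proof -
      have "c1 * (x / n) powr t * 1 \<le> c1 * (x / n) powr t * ((1 + ln x) ^ \<delta> * n powr \<epsilon>)"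
        using c1 L n\<epsilon> mult_mono [OF L n\<epsilon>] by (intro mult_left_mono) auto
      also have "\<dots> = c1 * ((x / n) powr t * n powr \<epsilon>) * (1 + ln x) ^ \<delta>" by (simp only: mult_ac)
      also have "\<dots> = c1 * x powr t * (1 + ln x) ^ \<delta> * n powr -(t - \<epsilon>)"
        unfolding split by (simp only: mult_ac)
      finally show ?thesis by (simp only: mult_1_right)
    qed
    have c1_le: "c1 * z \<le> c * z" if "z \<ge> 0" for z
      using that c2 c3 by (simp add: c_def algebra_simps)
    have R: "norm (summatory f (x / n) - asymp_main a p (x / n)) \<le> c1 * (x / n) powr b"
      using x n by (intro c1) auto
    also have "\<dots> \<le> c1 * x powr b * (1 + ln x) ^ \<delta> * n powr -(b - \<epsilon>)" by (rule weaken)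
    also have "c1 * x powr b * (1 + ln x) ^ \<delta> * n powr -(b - \<epsilon>)
        \<le> c * x powr b * (1 + ln x) ^ \<delta> * n powr -(b - \<epsilon>)"
      using c1_le [of "x powr b * (1 + ln x) ^ \<delta> * n powr -(b - \<epsilon>)"] x by (simp add: mult_ac)
    finally show "norm (summatory f (x / n) - asymp_main a p (x / n))
        \<le> c * x powr b * (1 + ln x) ^ \<delta> * n powr -(b - \<epsilon>)" .
    have "norm (poly p (complex_of_real (ln (x / n)))) \<le> c2 * (1 + \<bar>ln (x / n)\<bar>) ^ \<delta>"
      using c2(2) [of "complex_of_real (ln (x / n))"] by simp
    \<comment> \<open>The product form splits the logarithm into a factor in \<open>x\<close> and a
      factor in \<open>n\<close>.\<close>
    also have "1 + \<bar>ln (x / n)\<bar> \<le> (1 + ln x) * (1 + ln n)"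
    proof -
      have "0 \<le> ln x" "0 \<le> ln n" using x n by auto
      moreover from this have "0 \<le> ln x * ln n" by simp
      moreover have "ln (x / n) = ln x - ln n" using x n by (simp add: ln_div)
      moreover have "(1 + ln x) * (1 + ln n) = 1 + ln x + ln n + ln x * ln n"
        by (simp add: algebra_simps)
      ultimately show ?thesis by linarith
    qed
    then have "c2 * (1 + \<bar>ln (x / n)\<bar>) ^ \<delta> \<le> c2 * ((1 + ln x) * (1 + ln n)) ^ \<delta>"
      using c2 by (intro mult_left_mono power_mono) auto
    also have "\<dots> \<le> c2 * ((1 + ln x) ^ \<delta> * (c3 * n powr \<epsilon>))"
      unfolding power_mult_distrib using x n c3(2) [of "ln n"] c2
      by (intro mult_left_mono) (auto simp: powr_def)
    finally have "norm (asymp_main a p (x / n)) \<le> (x / n) powr a * (c2 * ((1 + ln x) ^ \<delta> * (c3 * n powr \<epsilon>)))"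
      unfolding asymp_main_def norm_mult by (intro mult_mono) auto
    also have "\<dots> = c2 * c3 * ((x / n) powr a * n powr \<epsilon>) * (1 + ln x) ^ \<delta>" by (simp only: mult_ac)
    finally have M: "norm (asymp_main a p (x / n)) \<le> c2 * c3 * x powr a * (1 + ln x) ^ \<delta> * n powr -(a - \<epsilon>)"
      unfolding split by (simp only: mult_ac)
    have z: "0 \<le> x powr a * (1 + ln x) ^ \<delta> * n powr -(a - \<epsilon>)" using x by auto
    have "c1 * (x powr a * (1 + ln x) ^ \<delta> * n powr -(a - \<epsilon>)) \<ge> 0"
      using c1(1) z by (rule mult_nonneg_nonneg)
    with M show "norm (asymp_main a p (x / n)) \<le> c * x powr a * (1 + ln x) ^ \<delta> * n powr -(a - \<epsilon>)"
      by (simp add: c_def algebra_simps)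
    show "norm (summatory f (x / n)) \<le> c * x powr a * (1 + ln x) ^ \<delta> * n powr -(a - \<epsilon>)"
    \<comment> \<open>For \<open>x / n < 1\<close> the power with exponent \<open>b\<close> exceeds
      the one with exponent \<open>a\<close>, so the error bound would be too weak; there the
      summatory function vanishes. Otherwise \<open>b < a\<close> gives the comparison.\<close>
    proof (cases "x / n < 1")
      case True
      then have "summatory f (x / n) = 0" by (rule summatory_eq_0)
      with c z show ?thesis using mult_nonneg_nonneg [OF c z] by (simp add: mult_ac)
    next
      case False
      have "(x / n) powr b \<le> (x / n) powr a" using False assms by (intro powr_mono) auto
      then have "c1 * (x / n) powr b \<le> c1 * (x / n) powr a" using c1 by (intro mult_left_mono)
      with R weaken [of a] have "norm (summatory f (x / n) - asymp_main a p (x / n))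
          \<le> c1 * x powr a * (1 + ln x) ^ \<delta> * n powr -(a - \<epsilon>)" by linarith
      with M have "norm (summatory f (x / n)) \<le> c1 * x powr a * (1 + ln x) ^ \<delta> * n powr -(a - \<epsilon>)
          + c2 * c3 * x powr a * (1 + ln x) ^ \<delta> * n powr -(a - \<epsilon>)"
        using norm_triangle_sub [of "summatory f (x / n)" "asymp_main a p (x / n)"] by linarith
      then show ?thesis by (simp add: c_def algebra_simps)
    qed
  qed
qed

section \<open>Telescoping a difference of products\<close>

text \<open>The factors are exchanged one at a time. In the \<open>j\<close>-th difference some of
  the other factors come from \<open>u\<close> and some from \<open>v\<close>, so \<open>B\<close>
  has to bound both.\<close>

lemma norm_prod_diff_le:
  fixes u v :: "'i \<Rightarrow> 'a::{real_normed_field}" and B :: "'i \<Rightarrow> real"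
  assumes "finite I" "\<And>i. i \<in> I \<Longrightarrow> norm (u i) \<le> B i" "\<And>i. i \<in> I \<Longrightarrow> norm (v i) \<le> B i"
  shows "norm (prod u I - prod v I) \<le> (\<Sum>j\<in>I. norm (u j - v j) * prod B (I - {j}))"
  using assms
proof (induction I rule: finite_induct)
  case (insert k I)
  have "prod u (insert k I) - prod v (insert k I) =
      (u k - v k) * prod u I + v k * (prod u I - prod v I)"
    using insert by (simp add: algebra_simps)
  also have "norm \<dots> \<le> norm (u k - v k) * norm (prod u I) + norm (v k) * norm (prod u I - prod v I)"
    by (intro norm_triangle_le add_mono) (auto simp: norm_mult)
  also have "\<dots> \<le> norm (u k - v k) * prod B I
      + B k * (\<Sum>j\<in>I. norm (u j - v j) * prod B (I - {j}))"
  proof (intro add_mono mult_left_mono mult_mono insert.IH)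
    have "norm (prod u I) = (\<Prod>i\<in>I. norm (u i))" by (simp add: prod_norm)
    also have "\<dots> \<le> prod B I" using insert by (intro prod_mono) auto
    finally show "norm (prod u I) \<le> prod B I" .
    show "0 \<le> B k" using insert.prems(1) [of k] norm_ge_zero [of "u k"] by (simp del: norm_ge_zero)
  qed (use insert in auto)
  also have "B k * (\<Sum>j\<in>I. norm (u j - v j) * prod B (I - {j}))
      = (\<Sum>j\<in>I. norm (u j - v j) * prod B (insert k I - {j}))"
  proof -
    have "prod B (insert k I - {j}) = B k * prod B (I - {j})" if "j \<in> I" for j
    proof -
      have "insert k I - {j} = insert k (I - {j})" using that insert.hyps by auto
      then show ?thesis using insert.hyps by simp
    qed
    then show ?thesis by (simp add: sum_distrib_left mult_ac)
  qed
  finally show ?case using insert.hyps by simp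
qed auto

section \<open>The box sum of a convolution as a sum over divisor tuples\<close>

lemma finite_bounded_pos_tuples:
  "finite {n :: 'r::finite \<Rightarrow> nat. n \<in> pos_tuples \<and> (\<forall>j. real (n j) \<le> x)}"
proof (rule finite_subset)
  show "{n :: 'r \<Rightarrow> nat. n \<in> pos_tuples \<and> (\<forall>j. real (n j) \<le> x)} \<subseteq> (UNIV \<rightarrow>\<^sub>E {..nat \<lfloor>x\<rfloor>})"
    by (auto simp: PiE_def le_nat_floor)
qed (intro finite_PiE; simp)

lemma prod_summatory:
  fixes f :: "'r::finite \<Rightarrow> nat \<Rightarrow> complex"
  shows "(\<Prod>j\<in>UNIV. summatory (f j) (y j)) =
    (\<Sum>m | m \<in> pos_tuples \<and> (\<forall>j. real (m j) \<le> y j). \<Prod>j\<in>UNIV. f j (m j))"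
proof -
  have "(\<Prod>j\<in>UNIV. summatory (f j) (y j)) =
    (\<Sum>m\<in>PiE UNIV (\<lambda>j. {n. 1 \<le> n \<and> real n \<le> y j}). \<Prod>j\<in>UNIV. f j (m j))"
    unfolding summatory_def using finite_pos_nat_le_real by (subst prod_sum_PiE) auto
  also have "PiE UNIV (\<lambda>j. {n. 1 \<le> n \<and> real n \<le> y j})
      = {m. m \<in> pos_tuples \<and> (\<forall>j. real (m j) \<le> y j)}"
    by (auto simp: PiE_def pos_tuples_def)
  finally show ?thesis .
qed

text \<open>For fixed \<open>d\<close> the condition \<open>d j * m j \<le> x\<close> reads
  \<open>m j \<le> x / d j\<close>, independently in each coordinate, so the inner sum over
  \<open>m\<close> factors into summatory functions.\<close>

lemma msummatory_mconvolution:
  fixes h g :: "('r::finite \<Rightarrow> nat) \<Rightarrow> complex"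
  assumes "\<And>n. n \<in> pos_tuples \<Longrightarrow> h n = mconvolution g f n"
  shows "msummatory h x = (\<Sum>d | d \<in> pos_tuples \<and> (\<forall>j. real (d j) \<le> x).
           g d * (\<Prod>j\<in>UNIV. summatory (f j) (x / d j)))"
proof -
  define N where "N = {n :: 'r \<Rightarrow> nat. n \<in> pos_tuples \<and> (\<forall>j. real (n j) \<le> x)}"
  define E where "E = (\<lambda>n :: 'r \<Rightarrow> nat. {(d, m). \<forall>j. d j * m j = n j})"
  define V where "V = (\<lambda>d :: 'r \<Rightarrow> nat. {m. m \<in> pos_tuples \<and> (\<forall>j. real (m j) \<le> x / d j)})"
  have finN: "finite N" unfolding N_def by (rule finite_bounded_pos_tuples)
  have finE: "finite (E n)" if "n \<in> N" for n
  proof (rule finite_subset)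
    show "E n \<subseteq> (UNIV \<rightarrow>\<^sub>E {..nat \<lfloor>x\<rfloor>}) \<times> (UNIV \<rightarrow>\<^sub>E {..nat \<lfloor>x\<rfloor>})"
    proof clarify
      fix d m assume dm: "(d, m) \<in> E n"
      have "d j \<le> nat \<lfloor>x\<rfloor> \<and> m j \<le> nat \<lfloor>x\<rfloor>" for j
      proof -
        have eq: "d j * m j = n j" using dm by (simp add: E_def)
        have "1 \<le> n j" "n j \<le> nat \<lfloor>x\<rfloor>" using that by (auto simp: N_def pos_tuples_def le_nat_floor)
        moreover have "d j dvd n j" "m j dvd n j" unfolding eq [symmetric] by simp_all
        then have "d j \<le> n j" "m j \<le> n j" using \<open>1 \<le> n j\<close> by (auto intro: dvd_imp_le)
        ultimately show ?thesis by linarith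
      qed
      then show "d \<in> UNIV \<rightarrow>\<^sub>E {..nat \<lfloor>x\<rfloor>} \<and> m \<in> UNIV \<rightarrow>\<^sub>E {..nat \<lfloor>x\<rfloor>}" by (auto simp: PiE_def)
    qed
    show "finite ((UNIV \<rightarrow>\<^sub>E {..nat \<lfloor>x\<rfloor>}) \<times> (UNIV \<rightarrow>\<^sub>E {..nat \<lfloor>x\<rfloor>}) :: (('r \<Rightarrow> nat) \<times> ('r \<Rightarrow> nat)) set)"
      by (intro finite_cartesian_product finite_PiE) auto
  qed
  have finV: "finite (V d)" if "d \<in> N" for d
  proof (rule finite_subset [OF _ finN])
    have "real (m j) \<le> x" if "real (m j) \<le> x / real (d j)" for m j
    proof -
      have d: "real (d j) \<ge> 1" using \<open>d \<in> N\<close> by (auto simp: N_def pos_tuples_def)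
      then have "real (m j) * 1 \<le> real (m j) * real (d j)" by (intro mult_left_mono) auto
      also have "\<dots> \<le> x" using that d by (simp add: field_simps)
      finally show ?thesis by simp
    qed
    then show "V d \<subseteq> N" by (auto simp: N_def V_def)
  qed
  have "msummatory h x = (\<Sum>n\<in>N. \<Sum>(d, m)\<in>E n. g d * (\<Prod>j\<in>UNIV. f j (m j)))"
    unfolding msummatory_def N_def using assms by (auto intro!: sum.cong simp: mconvolution_def E_def)
  also have "\<dots> = (\<Sum>(n, d, m)\<in>Sigma N E. g d * (\<Prod>j\<in>UNIV. f j (m j)))"
    using finN finE by (subst sum.Sigma) (auto simp: split_def)
  \<comment> \<open>The tuple \<open>n\<close> is the coordinatewise product of \<open>d\<close> and
    \<open>m\<close>, so forgetting it is a bijection; \<open>d j \<le> x\<close> follows from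
    \<open>m j \<ge> 1\<close>.\<close>
  also have "\<dots> = (\<Sum>(d, m)\<in>Sigma N V. g d * (\<Prod>j\<in>UNIV. f j (m j)))"
  proof (rule sum.reindex_bij_witness
      [of _ "\<lambda>(d, m). (\<lambda>j. d j * m j, d, m)" "\<lambda>(n, d, m). (d, m)"])
    fix z assume "z \<in> Sigma N E"
    then obtain n d m where z: "z = (n, d, m)" "n \<in> N" "\<And>j. d j * m j = n j"
      by (auto simp: E_def)
    have "1 \<le> d j \<and> 1 \<le> m j \<and> real (d j) \<le> x \<and> real (m j) \<le> x / d j" for j
    proof -
      have "d j * m j \<ge> 1" using z by (auto simp: N_def pos_tuples_def)
      then have pos: "1 \<le> d j" "1 \<le> m j" by (auto intro!: Suc_leI)
      have le: "real (d j) * real (m j) \<le> x"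
        unfolding of_nat_mult [symmetric] z(3) using z(2) by (simp add: N_def)
      have "real (d j) * 1 \<le> real (d j) * real (m j)" using pos by (intro mult_left_mono) auto
      with le have "real (d j) \<le> x" by linarith
      with pos le show ?thesis by (auto simp: field_simps)
    qed
    then show "(case z of (n, d, m) \<Rightarrow> (d, m)) \<in> Sigma N V"
      by (auto simp: z N_def V_def pos_tuples_def)
    show "(case case z of (n, d, m) \<Rightarrow> (d, m) of (d, m) \<Rightarrow> (\<lambda>j. d j * m j, d, m)) = z"
      using z by auto
  next
    fix z assume "z \<in> Sigma N V"
    then obtain d m where z: "z = (d, m)" "d \<in> N" "m \<in> V d" by auto
    have "1 \<le> d j * m j \<and> real (d j * m j) \<le> x" for j
    proof -
      have "1 \<le> d j" "1 \<le> m j" "real (m j) \<le> x / d j"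
        using z by (auto simp: N_def V_def pos_tuples_def)
      then show ?thesis by (auto simp: field_simps)
    qed
    then show "(case z of (d, m) \<Rightarrow> (\<lambda>j. d j * m j, d, m)) \<in> Sigma N E"
      by (auto simp: z N_def E_def pos_tuples_def)
  qed (auto)
  also have "\<dots> = (\<Sum>d\<in>N. \<Sum>m\<in>V d. g d * (\<Prod>j\<in>UNIV. f j (m j)))"
    using finN finV by (subst sum.Sigma) auto
  also have "\<dots> = (\<Sum>d\<in>N. g d * (\<Prod>j\<in>UNIV. summatory (f j) (x / d j)))"
    unfolding prod_summatory V_def by (simp add: sum_distrib_left)
  finally show ?thesis unfolding N_def .
qed

section \<open>Dirichlet series at real points, and expansion of the main term in powers of
  \<open>ln x\<close>\<close>

lemma mdirichlet_term_of_real: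
  "mdirichlet_term g (\<lambda>j. complex_of_real (s j)) n =
     g n * complex_of_real (\<Prod>j\<in>UNIV. real (n j) powr - s j)"
proof -
  have "of_nat k powr complex_of_real t = complex_of_real (real k powr t)" for k t
    using powr_of_real [of "real k" t] by simp
  then show ?thesis
    by (simp add: mdirichlet_term_def powr_minus prod_inversef [symmetric] divide_inverse)
qed

lemma mdirichlet_abs_conv_of_real_iff:
  "mdirichlet_abs_conv g (\<lambda>j. complex_of_real (s j)) \<longleftrightarrow>
     (\<lambda>n. norm (g n) * (\<Prod>j\<in>UNIV. real (n j) powr - s j)) summable_on pos_tuples"
proof -
  have "norm (mdirichlet_term g (\<lambda>j. complex_of_real (s j)) n)
      = norm (g n) * (\<Prod>j\<in>UNIV. real (n j) powr - s j)" for n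
    unfolding mdirichlet_term_of_real norm_mult norm_of_real by (simp add: prod_nonneg)
  then show ?thesis unfolding mdirichlet_abs_conv_def by simp
qed

text \<open>Coefficient of \<open>u ^ k\<close> in \<open>p (u - t)\<close>; the binomial coefficient kills the terms
  with \<open>n < k\<close>, where the exponent is truncated.\<close>

definition shift_coeff :: "complex poly \<Rightarrow> nat \<Rightarrow> real \<Rightarrow> complex" where
  "shift_coeff p k t =
     (\<Sum>n\<le>degree p. coeff p n * of_nat (n choose k) * (- complex_of_real t) ^ (n - k))"

text \<open>Binomial expansion. Each power is expanded up to \<open>degree p\<close>, padded with
  zero binomial coefficients, so that the two sums can be interchanged. It is applied with
  \<open>u = ln x\<close> and \<open>t = ln n\<close>.\<close>

lemma poly_shift: "poly p (u - complex_of_real t) = (\<Sum>k\<le>degree p. shift_coeff p k t * u ^ k)"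
proof -
  have "(u - of_real t) ^ n =
      (\<Sum>k\<le>degree p. of_nat (n choose k) * (- complex_of_real t) ^ (n - k) * u ^ k)"
    if "n \<le> degree p" for n
  proof -
    have "(u - of_real t) ^ n = (\<Sum>k\<le>n. of_nat (n choose k) * (- complex_of_real t) ^ (n - k) * u ^ k)"
      using binomial_ring [of u "- complex_of_real t" n] by (simp add: mult_ac)
    also have "\<dots> = (\<Sum>k\<le>degree p. of_nat (n choose k) * (- complex_of_real t) ^ (n - k) * u ^ k)"
      using that by (intro sum.mono_neutral_left) auto
    finally show ?thesis .
  qed
  then have "poly p (u - complex_of_real t) = (\<Sum>n\<le>degree p. \<Sum>k\<le>degree p.
      coeff p n * (of_nat (n choose k) * (- complex_of_real t) ^ (n - k) * u ^ k))"
    by (simp add: poly_altdef sum_distrib_left)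
  also have "\<dots> = (\<Sum>k\<le>degree p. shift_coeff p k t * u ^ k)"
    by (subst sum.swap) (simp add: shift_coeff_def sum_distrib_left sum_distrib_right mult_ac)
  finally show ?thesis .
qed

text \<open>Only the top coefficient contributes, and the power of \<open>t\<close> in it has
  exponent 0. Hence no logarithm of \<open>n\<close> enters the coefficient of highest
  degree.\<close>

lemma shift_coeff_degree [simp]: "shift_coeff p (degree p) t = lead_coeff p"
proof -
  have "shift_coeff p (degree p) t = (\<Sum>n\<in>{degree p}. coeff p n * of_nat (n choose degree p) * (- complex_of_real t) ^ (n - degree p))"
    unfolding shift_coeff_def by (intro sum.mono_neutral_right) auto
  then show ?thesis by simp
qed

text \<open>The shift coefficient is a fixed polynomial \<open>q\<close> evaluated at
  \<open>- t\<close>, and a polynomial in \<open>ln n\<close> is dominated by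
  \<open>n powr \<epsilon>\<close>.\<close>

lemma norm_shift_coeff_ln_le:
  fixes \<epsilon> :: real
  assumes "\<epsilon> > 0"
  shows "\<exists>c\<ge>0. \<forall>n\<ge>1::nat. norm (shift_coeff p k (ln n)) \<le> c * n powr \<epsilon>"
proof -
  define q where "q = (\<Sum>n\<le>degree p. monom (coeff p n * of_nat (n choose k)) (n - k))"
  obtain c where c: "c \<ge> 0" "\<And>u. norm (poly q u) \<le> c * exp (\<epsilon> * norm u)"
    using norm_poly_le_exp [OF assms] by blast
  have "norm (shift_coeff p k (ln n)) \<le> c * n powr \<epsilon>" if "n \<ge> (1::nat)" for n
    using c(2) [of "- complex_of_real (ln n)"] that
    by (simp add: q_def shift_coeff_def poly_sum poly_monom powr_def)
  with c(1) show ?thesis by blast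
qed

text \<open>Multiplying out over multi-indices \<open>k\<close> leaves finitely many terms, each a
  function of \<open>x\<close> times a function of \<open>n\<close>, so the sum over
  \<open>n\<close> can be taken coefficient by coefficient.\<close>

lemma prod_asymp_main:
  fixes P :: "'r::finite \<Rightarrow> complex poly"
  assumes x: "x > 0" and n: "n \<in> pos_tuples"
  shows "(\<Prod>j\<in>UNIV. asymp_main (a j) (P j) (x / n j)) =
    (\<Sum>k\<in>PiE UNIV (\<lambda>j. {..degree (P j)}). complex_of_real (x powr (\<Sum>j\<in>UNIV. a j)) *
      (complex_of_real (\<Prod>j\<in>UNIV. n j powr - a j) * (\<Prod>j\<in>UNIV. shift_coeff (P j) (k j) (ln (n j)))) *
      complex_of_real (ln x) ^ (\<Sum>j\<in>UNIV. k j))"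
proof -
  have "asymp_main (a j) (P j) (x / n j) = complex_of_real (x powr a j) *
      complex_of_real (n j powr - a j) *
      (\<Sum>k\<le>degree (P j). shift_coeff (P j) k (ln (n j)) * complex_of_real (ln x) ^ k)" for j
  proof -
    have nj: "real (n j) > 0" using n by (simp add: pos_tuples_def Suc_le_eq)
    then have "complex_of_real (ln (x / n j)) = complex_of_real (ln x) - complex_of_real (ln (n j))"
      using x by (simp add: ln_div)
    moreover have "(x / n j) powr a j = x powr a j * n j powr - a j"
      using powr_divide [of x "n j" "a j"] nj x by (simp add: powr_minus field_simps)
    ultimately show ?thesis unfolding asymp_main_def by (simp add: poly_shift)
  qed
  then have "(\<Prod>j\<in>UNIV. asymp_main (a j) (P j) (x / n j)) =
      complex_of_real (\<Prod>j\<in>UNIV. x powr a j) * complex_of_real (\<Prod>j\<in>UNIV. n j powr - a j) *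
      (\<Prod>j\<in>UNIV. \<Sum>k\<le>degree (P j). shift_coeff (P j) k (ln (n j)) * complex_of_real (ln x) ^ k)"
    by (simp add: prod.distrib)
  also have "(\<Prod>j\<in>UNIV. x powr a j) = x powr (\<Sum>j\<in>UNIV. a j)"
    using x by (simp add: powr_sum)
  also have "(\<Prod>j\<in>UNIV. \<Sum>k\<le>degree (P j). shift_coeff (P j) k (ln (n j)) * complex_of_real (ln x) ^ k) =
      (\<Sum>k\<in>PiE UNIV (\<lambda>j. {..degree (P j)}). (\<Prod>j\<in>UNIV. shift_coeff (P j) (k j) (ln (n j))) *
        complex_of_real (ln x) ^ (\<Sum>j\<in>UNIV. k j))"
    by (subst prod_sum_PiE) (auto simp: prod.distrib power_sum)
  finally show ?thesis by (simp only: sum_distrib_left mult_ac)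
qed

text \<open>A multi-index \<open>k \<le> \<delta>\<close> with the same total as
  \<open>\<delta>\<close> must equal \<open>\<delta>\<close>, so a single \<open>\<kappa>\<close>
  contributes in the top degree.\<close>

lemma sum_monom_PiE:
  fixes \<kappa> :: "('r::finite \<Rightarrow> nat) \<Rightarrow> 'a::comm_monoid_add" and \<delta> :: "'r \<Rightarrow> nat"
  defines "Q \<equiv> (\<Sum>k\<in>PiE UNIV (\<lambda>j. {..\<delta> j}). monom (\<kappa> k) (\<Sum>j\<in>UNIV. k j))"
  shows "degree Q \<le> (\<Sum>j\<in>UNIV. \<delta> j)" and "coeff Q (\<Sum>j\<in>UNIV. \<delta> j) = \<kappa> \<delta>"
proof -
  have fin: "finite (PiE UNIV (\<lambda>j. {..\<delta> j}))" by (intro finite_PiE) auto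
  show "degree Q \<le> (\<Sum>j\<in>UNIV. \<delta> j)" unfolding Q_def
  proof (rule degree_sum_le [OF fin])
    fix k assume "k \<in> PiE UNIV (\<lambda>j. {..\<delta> j})"
    then have "(\<Sum>j\<in>UNIV. k j) \<le> (\<Sum>j\<in>UNIV. \<delta> j)" by (intro sum_mono) auto
    then show "degree (monom (\<kappa> k) (\<Sum>j\<in>UNIV. k j)) \<le> (\<Sum>j\<in>UNIV. \<delta> j)"
      by (rule order_trans [OF degree_monom_le])
  qed
  have "k = \<delta>" if "k \<in> PiE UNIV (\<lambda>j. {..\<delta> j})" "(\<Sum>j\<in>UNIV. k j) = (\<Sum>j\<in>UNIV. \<delta> j)" for k
    using sum_mono_inv [OF that(2)] that(1) by auto
  then have "coeff Q (\<Sum>j\<in>UNIV. \<delta> j) =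
      (\<Sum>k\<in>PiE UNIV (\<lambda>j. {..\<delta> j}). if k = \<delta> then \<kappa> k else 0)"
    unfolding Q_def coeff_sum coeff_monom by (intro sum.cong) auto
  also have "\<dots> = \<kappa> \<delta>" using fin by (subst sum.delta) auto
  finally show "coeff Q (\<Sum>j\<in>UNIV. \<delta> j) = \<kappa> \<delta>" .
qed

section \<open>Exact sum and main term as series over all tuples\<close>

text \<open>If some \<open>d j > x\<close>, then \<open>x / d j < 1\<close> and the corresponding
  factor is 0. Padding the finite sum with zeros puts it on the index set of the main-term series,
  so the two can be compared term by term.\<close>

lemma msummatory_mconvolution_has_sum:
  fixes h g :: "('r::finite \<Rightarrow> nat) \<Rightarrow> complex"
  assumes "\<And>n. n \<in> pos_tuples \<Longrightarrow> h n = mconvolution g f n"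
  shows "((\<lambda>d. g d * (\<Prod>j\<in>UNIV. summatory (f j) (x / d j))) has_sum msummatory h x) pos_tuples"
proof (rule has_sum_finite_neutralI)
  show "finite {d :: 'r \<Rightarrow> nat. d \<in> pos_tuples \<and> (\<forall>j. real (d j) \<le> x)}"
    by (rule finite_bounded_pos_tuples)
  show "msummatory h x = (\<Sum>d | d \<in> pos_tuples \<and> (\<forall>j. real (d j) \<le> x).
           g d * (\<Prod>j\<in>UNIV. summatory (f j) (x / d j)))"
    using assms by (rule msummatory_mconvolution)
  fix d :: "'r \<Rightarrow> nat"
  assume d: "d \<in> pos_tuples - {d. d \<in> pos_tuples \<and> (\<forall>j. real (d j) \<le> x)}"
  then obtain j where j: "x < real (d j)" by (auto simp: not_le)
  have "1 \<le> d j" using d by (simp add: pos_tuples_def)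
  with j have "x / d j < 1" by (simp add: field_simps)
  then have "summatory (f j) (x / d j) = 0" by (rule summatory_eq_0)
  then show "g d * (\<Prod>j\<in>UNIV. summatory (f j) (x / d j)) = 0"
    by (auto intro!: prod_zero)
qed auto

text \<open>Each shift coefficient costs at most a factor \<open>n j powr \<epsilon>\<close>, which
  the room between \<open>a j\<close> and \<open>a j - \<epsilon>\<close> pays for.\<close>

lemma summable_shift_coeff_prod:
  fixes g :: "('r::finite \<Rightarrow> nat) \<Rightarrow> complex"
  assumes "\<epsilon> > 0"
    and "(\<lambda>n. norm (g n) * (\<Prod>j\<in>UNIV. real (n j) powr -(a j - \<epsilon>))) summable_on pos_tuples"
  shows "(\<lambda>n. g n * (complex_of_real (\<Prod>j\<in>UNIV. n j powr - a j) *
      (\<Prod>j\<in>UNIV. shift_coeff (P j) (k j) (ln (n j))))) summable_on pos_tuples"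
proof -
  have "\<forall>j. \<exists>c\<ge>0. \<forall>n\<ge>1::nat. norm (shift_coeff (P j) (k j) (ln n)) \<le> c * n powr \<epsilon>"
    using norm_shift_coeff_ln_le [OF assms(1)] by blast
  then obtain c where c: "\<And>j. c j \<ge> 0"
    "\<And>j n. n \<ge> (1::nat) \<Longrightarrow> norm (shift_coeff (P j) (k j) (ln n)) \<le> c j * n powr \<epsilon>"
    by metis
  show ?thesis
  proof (rule abs_summable_summable, rule Infinite_Sum.abs_summable_on_comparison_test')
    show "(\<lambda>n. prod c UNIV * (norm (g n) * (\<Prod>j\<in>UNIV. real (n j) powr -(a j - \<epsilon>)))) summable_on pos_tuples"
      by (intro summable_on_cmult_right assms)
    fix n :: "'r \<Rightarrow> nat" assume "n \<in> pos_tuples"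
    then have n: "1 \<le> n j" for j by (simp add: pos_tuples_def)
    have "norm (g n * (complex_of_real (\<Prod>j\<in>UNIV. n j powr - a j) *
        (\<Prod>j\<in>UNIV. shift_coeff (P j) (k j) (ln (n j)))))
      = norm (g n) * (\<Prod>j\<in>UNIV. n j powr - a j * norm (shift_coeff (P j) (k j) (ln (n j))))"
      unfolding norm_mult norm_of_real prod.distrib by (simp add: prod_nonneg prod_norm)
    also have "\<dots> \<le> norm (g n) * (\<Prod>j\<in>UNIV. n j powr - a j * (c j * n j powr \<epsilon>))"
      using c n by (intro mult_left_mono prod_mono conjI) auto
    also have "(\<Prod>j\<in>UNIV. n j powr - a j * (c j * n j powr \<epsilon>)) = (\<Prod>j\<in>UNIV. c j * n j powr -(a j - \<epsilon>))"
    proof (intro prod.cong refl)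
      fix j
      have "n j powr -(a j - \<epsilon>) = n j powr - a j * n j powr \<epsilon>"
        by (simp add: powr_add [symmetric])
      then show "n j powr - a j * (c j * n j powr \<epsilon>) = c j * n j powr -(a j - \<epsilon>)"
        by (simp only: mult_ac)
    qed
    finally show "norm (g n * (complex_of_real (\<Prod>j\<in>UNIV. n j powr - a j) *
        (\<Prod>j\<in>UNIV. shift_coeff (P j) (k j) (ln (n j)))))
      \<le> prod c UNIV * (norm (g n) * (\<Prod>j\<in>UNIV. real (n j) powr -(a j - \<epsilon>)))"
      by (simp add: prod.distrib mult_ac)
  qed
qed

lemma has_sum_sum:
  fixes F :: "'i \<Rightarrow> 'a \<Rightarrow> 'b::topological_comm_monoid_add"
  assumes "finite I" "\<And>i. i \<in> I \<Longrightarrow> (F i has_sum S i) A"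
  shows "((\<lambda>x. \<Sum>i\<in>I. F i x) has_sum (\<Sum>i\<in>I. S i)) A"
  using assms by (induction I rule: finite_induct) (auto intro: has_sum_add)

text \<open>The coefficients of \<open>Q\<close> collect the series \<open>\<kappa> k\<close> by the
  total of \<open>k\<close>. The degree is only bounded, because the coefficient at \<open>D\<close>
  vanishes when the Dirichlet series is 0 at \<open>a\<close>.\<close>

lemma main_term_has_sum:
  fixes g :: "('r::finite \<Rightarrow> nat) \<Rightarrow> complex" and P :: "'r \<Rightarrow> complex poly" and a :: "'r \<Rightarrow> real"
  assumes "\<epsilon> > 0"
    and "(\<lambda>n. norm (g n) * (\<Prod>j\<in>UNIV. real (n j) powr -(a j - \<epsilon>))) summable_on pos_tuples"
  defines "D \<equiv> (\<Sum>j\<in>UNIV. degree (P j))"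
  obtains Q where "degree Q \<le> D"
    "coeff Q D = (\<Prod>j\<in>UNIV. lead_coeff (P j)) * mdirichlet g (\<lambda>j. complex_of_real (a j))"
    "\<And>x. x > 0 \<Longrightarrow> ((\<lambda>n. g n * (\<Prod>j\<in>UNIV. asymp_main (a j) (P j) (x / n j))) has_sum
       complex_of_real (x powr (\<Sum>j\<in>UNIV. a j)) * poly Q (complex_of_real (ln x))) pos_tuples"
proof -
  define \<tau> where "\<tau> = (\<lambda>k n. g n * (complex_of_real (\<Prod>j\<in>UNIV. n j powr - a j) *
      (\<Prod>j\<in>UNIV. shift_coeff (P j) (k j) (ln (n j)))))"
  define \<kappa> where "\<kappa> = (\<lambda>k. infsum (\<tau> k) pos_tuples)"
  define Q where "Q = (\<Sum>k\<in>PiE UNIV (\<lambda>j. {..degree (P j)}). monom (\<kappa> k) (\<Sum>j\<in>UNIV. k j))"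
  have \<tau>: "(\<tau> k has_sum \<kappa> k) pos_tuples" for k
    unfolding \<kappa>_def \<tau>_def using summable_shift_coeff_prod [OF assms(1,2)]
    by (rule has_sum_infsum)
  have fin: "finite (PiE UNIV (\<lambda>j. {..degree (P j)}))" by (intro finite_PiE) auto
  show thesis
  proof (rule that)
    show "degree Q \<le> D" unfolding Q_def D_def by (rule sum_monom_PiE)
    have "\<tau> (\<lambda>j. degree (P j)) = (\<lambda>n. (\<Prod>j\<in>UNIV. lead_coeff (P j)) *
        mdirichlet_term g (\<lambda>j. complex_of_real (a j)) n)"
      unfolding \<tau>_def mdirichlet_term_of_real by (simp add: mult_ac)
    then have "\<kappa> (\<lambda>j. degree (P j)) =
        (\<Prod>j\<in>UNIV. lead_coeff (P j)) * mdirichlet g (\<lambda>j. complex_of_real (a j))"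
      unfolding \<kappa>_def mdirichlet_def by (simp add: infsum_cmult_right')
    then show "coeff Q D = (\<Prod>j\<in>UNIV. lead_coeff (P j)) * mdirichlet g (\<lambda>j. complex_of_real (a j))"
      unfolding Q_def D_def by (simp add: sum_monom_PiE)
    fix x :: real assume x: "x > 0"
    let ?X = "complex_of_real (x powr (\<Sum>j\<in>UNIV. a j))" and ?L = "complex_of_real (ln x)"
    have "((\<lambda>n. \<Sum>k\<in>PiE UNIV (\<lambda>j. {..degree (P j)}). ?X * ?L ^ (\<Sum>j\<in>UNIV. k j) * \<tau> k n) has_sum
        (\<Sum>k\<in>PiE UNIV (\<lambda>j. {..degree (P j)}). ?X * ?L ^ (\<Sum>j\<in>UNIV. k j) * \<kappa> k)) pos_tuples"
      using fin \<tau> by (intro has_sum_sum has_sum_cmult_right)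
    also have "(\<Sum>k\<in>PiE UNIV (\<lambda>j. {..degree (P j)}). ?X * ?L ^ (\<Sum>j\<in>UNIV. k j) * \<kappa> k) = ?X * poly Q ?L"
      unfolding Q_def poly_sum poly_monom sum_distrib_left by (simp only: mult_ac)
    finally show "((\<lambda>n. g n * (\<Prod>j\<in>UNIV. asymp_main (a j) (P j) (x / n j))) has_sum ?X * poly Q ?L) pos_tuples"
    proof (rule has_sum_cong [THEN iffD1, rotated])
      fix n :: "'r \<Rightarrow> nat" assume n: "n \<in> pos_tuples"
      show "(\<Sum>k\<in>PiE UNIV (\<lambda>j. {..degree (P j)}). ?X * ?L ^ (\<Sum>j\<in>UNIV. k j) * \<tau> k n) =
          g n * (\<Prod>j\<in>UNIV. asymp_main (a j) (P j) (x / n j))"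
        unfolding prod_asymp_main [OF x n] \<tau>_def sum_distrib_left by (simp only: mult_ac)
    qed
  qed
qed

section \<open>From termwise errors to the asymptotic formula\<close>

text \<open>Telescoping replaces \<open>a j\<close> by \<open>b j\<close> in one coordinate at a
  time: the exponent of \<open>x\<close> drops by \<open>a j - b j\<close>, and the weight in
  \<open>n\<close> is that of the \<open>j\<close>-th point where absolute convergence is
  assumed.\<close>

lemma norm_prod_summatory_error_le:
  fixes a b c :: "'r::finite \<Rightarrow> real" and n :: "'r \<Rightarrow> nat"
  assumes "x \<ge> 1" "n \<in> pos_tuples" "\<And>j. c j \<ge> 0"
    and bounds: "\<And>j k. k \<ge> (1::nat) \<Longrightarrow>
    norm (summatory (f j) (x / k) - asymp_main (a j) (P j) (x / k))
      \<le> c j * x powr b j * (1 + ln x) ^ degree (P j) * k powr -(b j - \<epsilon>) \<and>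
    norm (asymp_main (a j) (P j) (x / k)) \<le> c j * x powr a j * (1 + ln x) ^ degree (P j) * k powr -(a j - \<epsilon>) \<and>
    norm (summatory (f j) (x / k)) \<le> c j * x powr a j * (1 + ln x) ^ degree (P j) * k powr -(a j - \<epsilon>)"
  shows "norm ((\<Prod>j\<in>UNIV. summatory (f j) (x / n j)) - (\<Prod>j\<in>UNIV. asymp_main (a j) (P j) (x / n j))) \<le>
    (\<Sum>j\<in>UNIV. prod c UNIV * x powr ((\<Sum>i\<in>UNIV. a i) - (a j - b j)) *
      (1 + ln x) ^ (\<Sum>i\<in>UNIV. degree (P i)) *
      (\<Prod>i\<in>UNIV. real (n i) powr -(if i = j then b j - \<epsilon> else a i - \<epsilon>)))"
proof -
  have n: "1 \<le> n j" for j using assms by (simp add: pos_tuples_def)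
  define B where "B = (\<lambda>i. c i * x powr a i * (1 + ln x) ^ degree (P i) * n i powr -(a i - \<epsilon>))"
  have B: "B i \<ge> 0" for i using assms by (simp add: B_def)
  have "norm ((\<Prod>j\<in>UNIV. summatory (f j) (x / n j)) - (\<Prod>j\<in>UNIV. asymp_main (a j) (P j) (x / n j))) \<le>
      (\<Sum>j\<in>UNIV. norm (summatory (f j) (x / n j) - asymp_main (a j) (P j) (x / n j)) * prod B (UNIV - {j}))"
    by (rule norm_prod_diff_le) (use bounds n in \<open>auto simp: B_def\<close>)
  also have "\<dots> \<le> (\<Sum>j\<in>UNIV. prod c UNIV * x powr ((\<Sum>i\<in>UNIV. a i) - (a j - b j)) *
      (1 + ln x) ^ (\<Sum>i\<in>UNIV. degree (P i)) *
      (\<Prod>i\<in>UNIV. real (n i) powr -(if i = j then b j - \<epsilon> else a i - \<epsilon>)))"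
  proof (rule sum_mono)
    fix j :: 'r
    \<comment> \<open>With this exponent vector the error in coordinate \<open>j\<close> and the
      bounds \<open>B\<close> elsewhere form one product over all coordinates.\<close>
    define e where "e = (\<lambda>i. if i = j then b j else a i)"
    have "norm (summatory (f j) (x / n j) - asymp_main (a j) (P j) (x / n j)) * prod B (UNIV - {j})
        \<le> (c j * x powr b j * (1 + ln x) ^ degree (P j) * n j powr -(b j - \<epsilon>)) * prod B (UNIV - {j})"
      using bounds [OF n] B by (intro mult_right_mono prod_nonneg) auto
    also have "\<dots> = (\<Prod>i\<in>UNIV. c i * x powr e i * (1 + ln x) ^ degree (P i) *
        n i powr -(if i = j then b j - \<epsilon> else a i - \<epsilon>))"
      by (subst prod.remove [of UNIV j]) (auto simp: e_def B_def intro!: prod.cong)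
    also have "\<dots> = prod c UNIV * x powr (\<Sum>i\<in>UNIV. e i) * (1 + ln x) ^ (\<Sum>i\<in>UNIV. degree (P i)) *
        (\<Prod>i\<in>UNIV. real (n i) powr -(if i = j then b j - \<epsilon> else a i - \<epsilon>))"
      using assms(1) by (simp add: prod.distrib powr_sum power_sum)
    also have "(\<Sum>i\<in>UNIV. e i) = (\<Sum>i\<in>UNIV. a i) - (a j - b j)"
      by (simp add: e_def sum.remove [of UNIV j])
    finally show "norm (summatory (f j) (x / n j) - asymp_main (a j) (P j) (x / n j)) * prod B (UNIV - {j})
      \<le> prod c UNIV * x powr ((\<Sum>i\<in>UNIV. a i) - (a j - b j)) * (1 + ln x) ^ (\<Sum>i\<in>UNIV. degree (P i)) *
        (\<Prod>i\<in>UNIV. real (n i) powr -(if i = j then b j - \<epsilon> else a i - \<epsilon>))" .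
  qed
  finally show ?thesis .
qed

theorem theorem3:
  fixes h g :: "('r::finite \<Rightarrow> nat) \<Rightarrow> complex"
    and f :: "'r \<Rightarrow> nat \<Rightarrow> complex"
    and a b :: "'r \<Rightarrow> real"
    and P :: "'r \<Rightarrow> complex poly"
    and \<delta> :: "'r \<Rightarrow> nat"
    and K :: "'r \<Rightarrow> complex"
  assumes r_ge_2: "CARD('r) \<ge> 2"
    and h_eq: "\<And>n. n \<in> pos_tuples \<Longrightarrow> h n = mconvolution g f n"
    and b_pos: "\<And>j. 0 < b j"
    and b_less_a: "\<And>j. b j < a j"
    and P_nonzero: "\<And>j. P j \<noteq> 0"
    and P_degree: "\<And>j. degree (P j) = \<delta> j"
    and P_lead: "\<And>j. lead_coeff (P j) = K j"
    and F_asymp: "\<And>j. (\<lambda>x. summatory (f j) x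
                    - complex_of_real (x powr a j) * poly (P j) (complex_of_real (ln x)))
                  \<in> O[at_top](\<lambda>x. complex_of_real (x powr b j))"
    and G_conv: "\<And>j. \<forall>\<^sub>F \<epsilon> in at_right (0::real).
                  mdirichlet_abs_conv g
                    (\<lambda>i. complex_of_real (if i = j then b j - \<epsilon> else a i - \<epsilon>))"
  defines "\<Delta> \<equiv> (MIN j\<in>UNIV. a j - b j)"
    and "D \<equiv> (\<Sum>j\<in>UNIV. \<delta> j)"
    and "A \<equiv> (\<Sum>j\<in>UNIV. a j)"
    and "C \<equiv> (\<Prod>j\<in>UNIV. K j) * mdirichlet g (\<lambda>j. complex_of_real (a j))"
  shows "\<exists>Q :: complex poly.
           degree Q \<le> D \<and> coeff Q D = C \<and>
           (C \<noteq> 0 \<longrightarrow> degree Q = D \<and> lead_coeff Q = C) \<and>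
           (\<lambda>x. msummatory h x
                - complex_of_real (x powr A) * poly Q (complex_of_real (ln x)))
             \<in> O[at_top](\<lambda>x. complex_of_real (x powr (A - \<Delta>) * ln x ^ D))"
proof -
  have "\<forall>\<^sub>F \<epsilon> in at_right (0::real). \<epsilon> > 0 \<and> (\<forall>j. mdirichlet_abs_conv g
      (\<lambda>i. complex_of_real (if i = j then b j - \<epsilon> else a i - \<epsilon>)))"
    using G_conv by (intro eventually_conj eventually_at_right_less eventually_all_finite)
  \<comment> \<open>A single \<open>\<epsilon>\<close> serves every \<open>j\<close>, since finitely
    many eventual conditions hold simultaneously.\<close>
  then obtain \<epsilon> where \<epsilon>: "\<epsilon> > 0" and conv: "\<And>j. mdirichlet_abs_conv g
      (\<lambda>i. complex_of_real (if i = j then b j - \<epsilon> else a i - \<epsilon>))"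
    using eventually_happens' [OF trivial_limit_at_right_real] by blast
  define W where "W = (\<lambda>j n. norm (g n) *
      (\<Prod>i\<in>UNIV. real (n i) powr -(if i = j then b j - \<epsilon> else a i - \<epsilon>)))"
  have W: "(W j has_sum infsum (W j) pos_tuples) pos_tuples" for j
    using conv [of j] unfolding mdirichlet_abs_conv_of_real_iff W_def by (rule has_sum_infsum)
  \<comment> \<open>Any one \<open>W j\<close> dominates: lowering the exponent in coordinate
    \<open>j\<close> from \<open>a j - \<epsilon>\<close> to \<open>b j - \<epsilon>\<close> only
    enlarges the terms, as \<open>n j \<ge> 1\<close>.\<close>
  have conv_a: "(\<lambda>n. norm (g n) * (\<Prod>j\<in>UNIV. real (n j) powr -(a j - \<epsilon>))) summable_on pos_tuples"
  proof (rule summable_on_comparison_test)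
    fix j :: 'r
    show "W j summable_on pos_tuples" using W has_sum_imp_summable by blast
    fix n :: "'r \<Rightarrow> nat" assume "n \<in> pos_tuples"
    then have n: "1 \<le> n i" for i by (simp add: pos_tuples_def)
    show "norm (g n) * (\<Prod>i\<in>UNIV. real (n i) powr -(a i - \<epsilon>)) \<le> W j n"
      unfolding W_def using n b_less_a [of j]
      by (intro mult_left_mono prod_mono conjI powr_mono) auto
    show "0 \<le> norm (g n) * (\<Prod>i\<in>UNIV. real (n i) powr -(a i - \<epsilon>))" by (simp add: prod_nonneg)
  qed
  have D: "D = (\<Sum>j\<in>UNIV. degree (P j))" unfolding D_def P_degree ..
  have C: "C = (\<Prod>j\<in>UNIV. lead_coeff (P j)) * mdirichlet g (\<lambda>j. complex_of_real (a j))"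
    unfolding C_def P_lead ..
  obtain Q where Q: "degree Q \<le> D" "coeff Q D = C"
    "\<And>x. x > 0 \<Longrightarrow> ((\<lambda>n. g n * (\<Prod>j\<in>UNIV. asymp_main (a j) (P j) (x / n j))) has_sum
       complex_of_real (x powr A) * poly Q (complex_of_real (ln x))) pos_tuples"
    using main_term_has_sum [OF \<epsilon> conv_a, of P] unfolding D C A_def by blast
  have "\<exists>c\<ge>0. \<forall>x\<ge>1. \<forall>n\<ge>1::nat.
    norm (summatory (f j) (x / n) - asymp_main (a j) (P j) (x / n))
      \<le> c * x powr b j * (1 + ln x) ^ degree (P j) * n powr -(b j - \<epsilon>) \<and>
    norm (asymp_main (a j) (P j) (x / n)) \<le> c * x powr a j * (1 + ln x) ^ degree (P j) * n powr -(a j - \<epsilon>) \<and>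
    norm (summatory (f j) (x / n)) \<le> c * x powr a j * (1 + ln x) ^ degree (P j) * n powr -(a j - \<epsilon>)" for j
    using b_pos b_less_a \<epsilon> F_asymp unfolding asymp_main_def [symmetric]
    by (rule summatory_divisor_bounds)
  then obtain c where c: "\<And>j. c j \<ge> 0" "\<And>j x n. x \<ge> 1 \<Longrightarrow> n \<ge> (1::nat) \<Longrightarrow>
    norm (summatory (f j) (x / n) - asymp_main (a j) (P j) (x / n))
      \<le> c j * x powr b j * (1 + ln x) ^ degree (P j) * n powr -(b j - \<epsilon>) \<and>
    norm (asymp_main (a j) (P j) (x / n)) \<le> c j * x powr a j * (1 + ln x) ^ degree (P j) * n powr -(a j - \<epsilon>) \<and>
    norm (summatory (f j) (x / n)) \<le> c j * x powr a j * (1 + ln x) ^ degree (P j) * n powr -(a j - \<epsilon>)"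
    by metis
  let ?E = "\<lambda>x. msummatory h x - complex_of_real (x powr A) * poly Q (complex_of_real (ln x))"
  \<comment> \<open>The error is itself a series over all tuples, dominated termwise by a finite
    combination of the convergent \<open>W j\<close>; the dependence on \<open>x\<close> sits
    entirely in the coefficients.\<close>
  have E: "norm (?E x) \<le> (\<Sum>j\<in>UNIV. prod c UNIV * x powr (A - (a j - b j)) * (1 + ln x) ^ D *
      infsum (W j) pos_tuples)" if x: "x \<ge> 1" for x
  proof (rule norm_infsum_le)
    show "((\<lambda>n. g n * (\<Prod>j\<in>UNIV. summatory (f j) (x / n j)) +
        - (g n * (\<Prod>j\<in>UNIV. asymp_main (a j) (P j) (x / n j)))) has_sum ?E x) pos_tuples"
      using has_sum_add [OF msummatory_mconvolution_has_sum [OF h_eq] has_sum_uminusI [OF Q(3)], of x] x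
      by simp
    show "((\<lambda>n. \<Sum>j\<in>UNIV. prod c UNIV * x powr (A - (a j - b j)) * (1 + ln x) ^ D * W j n) has_sum
        (\<Sum>j\<in>UNIV. prod c UNIV * x powr (A - (a j - b j)) * (1 + ln x) ^ D * infsum (W j) pos_tuples)) pos_tuples"
      using W by (intro has_sum_sum has_sum_cmult_right) auto
    fix n :: "'r \<Rightarrow> nat" assume n: "n \<in> pos_tuples"
    have "norm (g n * (\<Prod>j\<in>UNIV. summatory (f j) (x / n j)) +
        - (g n * (\<Prod>j\<in>UNIV. asymp_main (a j) (P j) (x / n j)))) =
        norm (g n) * norm ((\<Prod>j\<in>UNIV. summatory (f j) (x / n j)) -
          (\<Prod>j\<in>UNIV. asymp_main (a j) (P j) (x / n j)))"
      by (simp add: norm_mult [symmetric] right_diff_distrib)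
    also have "\<dots> \<le> norm (g n) * (\<Sum>j\<in>UNIV. prod c UNIV * x powr (A - (a j - b j)) * (1 + ln x) ^ D *
        (\<Prod>i\<in>UNIV. real (n i) powr -(if i = j then b j - \<epsilon> else a i - \<epsilon>)))"
      unfolding A_def D using norm_prod_summatory_error_le [OF x n c] x
      by (intro mult_left_mono) auto
    also have "\<dots> = (\<Sum>j\<in>UNIV. prod c UNIV * x powr (A - (a j - b j)) * (1 + ln x) ^ D * W j n)"
      unfolding W_def sum_distrib_left by (simp only: mult_ac)
    finally show "norm (g n * (\<Prod>j\<in>UNIV. summatory (f j) (x / n j)) +
        - (g n * (\<Prod>j\<in>UNIV. asymp_main (a j) (P j) (x / n j))))
      \<le> (\<Sum>j\<in>UNIV. prod c UNIV * x powr (A - (a j - b j)) * (1 + ln x) ^ D * W j n)" .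
  qed
  \<comment> \<open>The factor \<open>2 ^ D\<close> comes from
    \<open>1 + ln x \<le> 2 * ln x\<close>, valid for \<open>x \<ge> exp 1\<close>.\<close>
  define T where "T = (\<Sum>j\<in>UNIV. prod c UNIV * 2 ^ D * infsum (W j) pos_tuples)"
  have "norm (?E x) \<le> T * norm (complex_of_real (x powr (A - \<Delta>) * ln x ^ D))" if x: "x \<ge> exp 1" for x
  proof -
    have x1: "x \<ge> 1" using x one_le_exp_iff [of "1::real"] by linarith
    have lnx: "ln x \<ge> 1" using x x1 by (simp add: ln_ge_iff)
    have "prod c UNIV * x powr (A - (a j - b j)) * (1 + ln x) ^ D * infsum (W j) pos_tuples
        \<le> prod c UNIV * x powr (A - \<Delta>) * (2 * ln x) ^ D * infsum (W j) pos_tuples" for j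
    proof -
      have "\<Delta> \<le> a j - b j" unfolding \<Delta>_def by (intro Min_le) auto
      then have "x powr (A - (a j - b j)) \<le> x powr (A - \<Delta>)" using x1 by (intro powr_mono) auto
      moreover have "(1 + ln x) ^ D \<le> (2 * ln x) ^ D" using lnx by (intro power_mono) auto
      moreover have "infsum (W j) pos_tuples \<ge> 0"
        unfolding W_def by (intro infsum_nonneg mult_nonneg_nonneg prod_nonneg) auto
      ultimately show ?thesis
        using c(1) lnx by (intro mult_right_mono mult_mono mult_left_mono mult_nonneg_nonneg prod_nonneg) auto
    qed
    then have "norm (?E x) \<le>
        (\<Sum>j\<in>UNIV. prod c UNIV * x powr (A - \<Delta>) * (2 * ln x) ^ D * infsum (W j) pos_tuples)"
      by (intro order_trans [OF E [OF x1]] sum_mono)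
    also have "\<dots> = T * (x powr (A - \<Delta>) * ln x ^ D)"
      unfolding T_def sum_distrib_right power_mult_distrib by (simp only: mult_ac)
    also have "x powr (A - \<Delta>) * ln x ^ D = norm (complex_of_real (x powr (A - \<Delta>) * ln x ^ D))"
      unfolding norm_of_real using lnx by simp
    finally show ?thesis .
  qed
  then have "?E \<in> O[at_top](\<lambda>x. complex_of_real (x powr (A - \<Delta>) * ln x ^ D))"
    by (intro bigoI [of _ T] eventually_at_top_linorderI)
  \<comment> \<open>If \<open>C \<noteq> 0\<close>, the nonzero coefficient at \<open>D\<close>
    forces the degree up to \<open>D\<close>.\<close>
  then show ?thesis
    using Q(1,2) le_degree [of Q D] by (intro exI [of _ Q]) auto
qed

end
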